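(* Let $(y_t)_{t\in\mathbb{Z}}$ be a real-valued time series, let $k,v,p,n_r$ be positive integers with $1\le v\le k$, let $r:\mathbb{R}^p\to\mathbb{R}^{n_r}$ be a function, and let $z_j=[y_j,y_{j-1},\ldots,y_{j-p+1}]^T\in\mathbb{R}^p$ for $j=0,1,\ldots,k$. Let $\|\cdot\|$ be a norm on $\mathbb{R}^p$. Let $\Phi_k\in\mathbb{R}^{n_r}$ and $e_k\in\mathbb{R}$ be such that $y_{k+1}=r(z_k)^T\Phi_k+e_k$, and for $j=1,\ldots,k$ let $e_{j-1}=y_j-r(z_{j-1})^T\Phi_k$. Assume that there are constants $\sigma,L\ge 0$ such that $$|e_{j-1}|\le \sigma+L\|z_{j-1}-z_k\|\quad (j=1,\ldots,k),\qquad |e_k|\le\sigma .$$ Let $A$ be the $v\times n_r$ matrix with $A^T=[\,r(z_0)\;\; r(z_1)\;\cdots\; r(z_{v-1})\,]$. Then for every $\Psi=(\Psi_1,\ldots,\Psi_v)^T\in\mathbb{R}^v$ such that $A^T\Psi=r(z_k)$, the prediction error $\hat e_k(\Psi)=y_{k+1}-\hat y_{k+1}(\Psi)$, where $\hat y_{k+1}(\Psi)=\sum_{j=1}^{v}\Psi_j y_j$, satisfies $$|\hat e_k(\Psi)|\le\sum_{j=1}^{v}|\Psi_j|\,\bigl(\sigma+L\|z_{j-1}-z_k\|\bigr)+\sigma .$$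
   Context: The function $r$ is an arbitrary known function (the "regressor generator function"); $z_j$ is the "embedding vector" of the $p$ most recent values at time $j$. The vector $\Phi_k$ is a fixed (unknown) parameter vector, the same in the definition of all the approximation errors $e_0,\ldots,e_{k-1}$ and in the model for $y_{k+1}$. The quantity $\hat y_{k+1}(\Psi)$ is the linear prediction of $y_{k+1}$ with weights $\Psi$. *)

theory Defs
  imports "Jordan_Normal_Form.Matrix"
begin

definition norm_on_carrier_vec :: "nat \<Rightarrow> (real vec \<Rightarrow> real) \<Rightarrow> bool" where
  "norm_on_carrier_vec n N \<longleftrightarrow>
     (\<forall>x \<in> carrier_vec n. 0 \<le> N x) \<and>
     (\<forall>x \<in> carrier_vec n. N x = 0 \<longleftrightarrow> x = 0\<^sub>v n) \<and>
     (\<forall>c. \<forall>x \<in> carrier_vec n. N (c \<cdot>\<^sub>v x) = \<bar>c\<bar> * N x) \<and>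
     (\<forall>x \<in> carrier_vec n. \<forall>y \<in> carrier_vec n. N (x + y) \<le> N x + N y)"

definition embedding_vec :: "(int \<Rightarrow> real) \<Rightarrow> nat \<Rightarrow> int \<Rightarrow> real vec" where
  "embedding_vec y p j = vec p (\<lambda>i. y (j - int i))"

text \<open>Vector entries are indexed from 0, so the weight of \<open>y j\<close> is the entry \<open>j - 1\<close> of
  \<open>\<Psi>\<close>.\<close>

definition prediction :: "(int \<Rightarrow> real) \<Rightarrow> nat \<Rightarrow> real vec \<Rightarrow> real" where
  "prediction y v \<Psi> = (\<Sum>j = 1..v. \<Psi> $ (j - 1) * y (int j))"

definition prediction_error :: "(int \<Rightarrow> real) \<Rightarrow> nat \<Rightarrow> nat \<Rightarrow> real vec \<Rightarrow> real" where
  "prediction_error y k v \<Psi> = y (int k + 1) - prediction y v \<Psi>"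

end

theory Submission
  imports Defs
begin

text \<open>The constraint \<open>A\<^sup>T \<Psi> = r (z k)\<close> makes the weighted regressor terms reproduce
  \<open>r (z k) \<bullet> \<Phi>\<close> exactly, whatever the unknown \<open>\<Phi>\<close> is. Hence \<open>\<Phi>\<close> cancels from the prediction
  error, which equals \<open>e k - (\<Sum>j = 1..v. \<Psi> $ (j - 1) * e (j - 1))\<close>; the triangle inequality
  finishes.\<close>

text \<open>Adjointness moves the matrix onto \<open>\<Phi>\<close>, and the rows of the transposed
  matrix are the columns \<open>c j\<close>.\<close>

lemma mat_of_cols_mult_scalar_prod:
  fixes c :: "nat \<Rightarrow> 'a::comm_semiring_0 vec"
  assumes c: "\<And>j. j < v \<Longrightarrow> c j \<in> carrier_vec n"
    and \<Psi>: "\<Psi> \<in> carrier_vec v" and \<Phi>: "\<Phi> \<in> carrier_vec n"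
  shows "(mat_of_cols n (map c [0..<v]) *\<^sub>v \<Psi>) \<bullet> \<Phi> = (\<Sum>j<v. \<Psi> $ j * (c j \<bullet> \<Phi>))"
proof -
  let ?B = "mat_of_cols n (map c [0..<v])"
  have B: "?B\<^sup>T \<in> carrier_mat v n"
    by (simp add: carrier_matI)
  \<comment> \<open>The adjointness rule is applied to \<open>?B\<^sup>T\<close>; the double
    transpose simplifies to \<open>?B\<close>.\<close>
  have "(?B *\<^sub>v \<Psi>) \<bullet> \<Phi> = \<Psi> \<bullet> (?B\<^sup>T *\<^sub>v \<Phi>)"
    using transpose_vec_mult_scalar[OF B \<Phi> \<Psi>] by simp
  also have "\<dots> = (\<Sum>j<v. \<Psi> $ j * (c j \<bullet> \<Phi>))"
    using c by (auto simp: scalar_prod_def[of \<Psi>] lessThan_atLeast0 intro!: sum.cong)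
  finally show ?thesis .
qed

text \<open>Separates the exact identity from the estimates. The constraint enters through
  \<open>yk\<close>, where the matrix-vector product already replaces the regressor at time
  \<open>k\<close>, so the same sum of terms \<open>\<Psi> $ j * (c j \<bullet> \<Phi>)\<close>
  occurs in the outcome and in the prediction.\<close>

lemma prediction_error_eq:
  assumes c: "\<And>j. j < v \<Longrightarrow> c j \<in> carrier_vec n"
    and \<Psi>: "\<Psi> \<in> carrier_vec v" and \<Phi>: "\<Phi> \<in> carrier_vec n"
    and y: "\<And>j. j < v \<Longrightarrow> y (int (Suc j)) = c j \<bullet> \<Phi> + e j"
    and yk: "y (int k + 1) = (mat_of_cols n (map c [0..<v]) *\<^sub>v \<Psi>) \<bullet> \<Phi> + e k"
  shows "prediction_error y k v \<Psi> = e k - (\<Sum>j<v. \<Psi> $ j * e j)"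
proof -
  have "prediction y v \<Psi> = (\<Sum>j<v. \<Psi> $ j * y (int (Suc j)))"
    unfolding prediction_def
    by (rule sum.reindex_bij_witness[of _ Suc "\<lambda>j. j - 1"]) auto
  also have "\<dots> = (\<Sum>j<v. \<Psi> $ j * (c j \<bullet> \<Phi>)) + (\<Sum>j<v. \<Psi> $ j * e j)"
    using y by (simp add: distrib_left sum.distrib)
  finally show ?thesis
    using mat_of_cols_mult_scalar_prod[OF c \<Psi> \<Phi>] yk
    by (simp add: prediction_error_def)
qed

theorem lemma1:
  fixes y :: "int \<Rightarrow> real"
    and k v p n\<^sub>r :: nat
    and r :: "real vec \<Rightarrow> real vec"
    and z :: "nat \<Rightarrow> real vec"
    and N :: "real vec \<Rightarrow> real"
    and \<Phi> :: "real vec"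
    and e :: "nat \<Rightarrow> real"
    and \<sigma> L :: real
    and A :: "real mat"
  assumes "0 < k" and "0 < p" and "0 < n\<^sub>r"
    and "1 \<le> v" and "v \<le> k"
    and "r \<in> carrier_vec p \<rightarrow> carrier_vec n\<^sub>r"
    and "\<forall>j \<in> {0..k}. z j = embedding_vec y p (int j)"
    and "norm_on_carrier_vec p N"
    and "\<Phi> \<in> carrier_vec n\<^sub>r"
    and "y (int k + 1) = r (z k) \<bullet> \<Phi> + e k"
    and "\<forall>j \<in> {1..k}. e (j - 1) = y (int j) - r (z (j - 1)) \<bullet> \<Phi>"
    and "0 \<le> \<sigma>" and "0 \<le> L"
    and "\<forall>j \<in> {1..k}. \<bar>e (j - 1)\<bar> \<le> \<sigma> + L * N (z (j - 1) - z k)"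
    and "\<bar>e k\<bar> \<le> \<sigma>"
    and "A \<in> carrier_mat v n\<^sub>r"
    and "transpose_mat A = mat_of_cols n\<^sub>r (map (\<lambda>j. r (z j)) [0..<v])"
  shows "\<forall>\<Psi> \<in> carrier_vec v. transpose_mat A *\<^sub>v \<Psi> = r (z k) \<longrightarrow>
    \<bar>prediction_error y k v \<Psi>\<bar>
      \<le> (\<Sum>j = 1..v. \<bar>\<Psi> $ (j - 1)\<bar> * (\<sigma> + L * N (z (j - 1) - z k))) + \<sigma>"
proof (intro ballI impI)
  fix \<Psi> :: "real vec"
  assume \<Psi>: "\<Psi> \<in> carrier_vec v" and eq: "transpose_mat A *\<^sub>v \<Psi> = r (z k)"
  \<comment> \<open>Since \<open>j < v\<close> and \<open>v \<le> k\<close>, \<open>z j\<close> is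
    an embedding vector and so lies in the domain of \<open>r\<close>.\<close>
  have c: "r (z j) \<in> carrier_vec n\<^sub>r" if "j < v" for j
    using that assms(5-7) by (auto simp: embedding_vec_def)
  have y: "y (int (Suc j)) = r (z j) \<bullet> \<Phi> + e j" if "j < v" for j
    using assms(11)[rule_format, of "Suc j"] that \<open>v \<le> k\<close> by simp
  have yk: "y (int k + 1) = (mat_of_cols n\<^sub>r (map (\<lambda>j. r (z j)) [0..<v]) *\<^sub>v \<Psi>) \<bullet> \<Phi> + e k"
    using assms(10,17) eq by simp
  have "prediction_error y k v \<Psi> = e k - (\<Sum>j<v. \<Psi> $ j * e j)"
    by (rule prediction_error_eq[where c = "\<lambda>j. r (z j)", OF c \<Psi> \<open>\<Phi> \<in> carrier_vec n\<^sub>r\<close> y yk])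
  also have "(\<Sum>j<v. \<Psi> $ j * e j) = (\<Sum>j = 1..v. \<Psi> $ (j - 1) * e (j - 1))"
    by (rule sum.reindex_bij_witness[of _ "\<lambda>j. j - 1" Suc]) auto
  finally have "\<bar>prediction_error y k v \<Psi>\<bar> \<le> \<bar>\<Sum>j = 1..v. \<Psi> $ (j - 1) * e (j - 1)\<bar> + \<bar>e k\<bar>"
    by linarith
  also have "\<dots> \<le> (\<Sum>j = 1..v. \<bar>\<Psi> $ (j - 1)\<bar> * (\<sigma> + L * N (z (j - 1) - z k))) + \<sigma>"
    \<comment> \<open>Here \<open>v \<le> k\<close> puts every summation index in the range of the
      error bounds, which then apply term by term with the nonnegative factors
      \<open>\<bar>\<Psi> $ (j - 1)\<bar>\<close>.\<close>
    using assms(5,14,15)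
    by (intro add_mono order.trans[OF sum_abs] sum_mono) (auto simp: abs_mult intro!: mult_left_mono)
  finally show "\<bar>prediction_error y k v \<Psi>\<bar>
      \<le> (\<Sum>j = 1..v. \<bar>\<Psi> $ (j - 1)\<bar> * (\<sigma> + L * N (z (j - 1) - z k))) + \<sigma>" .
qed

end
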